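(* Let $(a,b)\in\mathcal P$ with $0<b\le-a<1$, and let $m\ge1$ be such that $a\le T^mSb<a+1$. (I) Suppose that there exists $n\ge0$ such that $$\hat f^kT^mSb\in\Big(\frac b{b+1},a+1\Big)\text{ for }k<n,\quad\text{and}\quad \hat f^nT^mSb\in\Big[a,\frac b{b+1}\Big].$$ (i) If $\hat f^nT^mSb\in(a,\frac b{b+1})$, then $b$ has the cycle property; the cycle property is strong if and only if $\hat f^nT^mSb\ne0$. (ii) If $\hat f^nT^mSb=a$, then $b$ has the cycle property if and only if $a$ has the cycle property. (iii) If $\hat f^nT^mSb=\frac b{b+1}$, then $b$ does not have the cycle property, but the orbits of $Sb$ and $T^{-1}b$ are periodic. (II) If $\hat f^kT^mSb\in(\frac b{b+1},a+1)$ for all $k\ge0$, then $b$ does not have the cycle property.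
   Context: $T(x)=x+1$ and $S(x)=-1/x$, acting on $\bar{\mathbb R}=\mathbb R\cup\{\infty\}$ and generating the modular group $SL(2,\mathbb Z)$ (acting by fractional linear transformations). $\mathcal P=\{(a,b)\in\mathbb R^2 : a\le 0\le b,\ b-a\ge 1,\ -ab\le 1\}$. The map $f=f_{a,b}:\bar{\mathbb R}\to\bar{\mathbb R}$ is $f(x)=x+1$ if $x<a$, $f(x)=-1/x$ if $a\le x<b$, $f(x)=x-1$ if $x\ge b$. Its first return map to $[a,b)$ is $\hat f(x)=-\frac1x-\lfloor-\frac1x\rceil_{a,b}$, $\hat f(0)=0$, where $\lfloor x\rceil_{a,b}$ equals $\lfloor x-a\rfloor$ if $x<a$, $0$ if $a\le x<b$, $\lceil x-b\rceil$ if $x\ge b$, with $\lfloor\cdot\rfloor$ the integer part and $\lceil x\rceil:=\lfloor x\rfloor+1$. $\hat f^k$ denotes the $k$-th iterate. To $a$ one associates the upper orbit $\{f^n(Sa)\}$ and the lower orbit $\{f^n(Ta)\}$; to $b$ the lower orbit $\{f^n(Sb)\}$ and the upper orbit $\{f^n(T^{-1}b)\}$. Convention: if such an orbit hits $a$ or $b$, the next iterate is taken according to the type of the orbit: a lower orbit hitting $a$ (resp. $b$) continues with $Ta$ (resp. $Sb$), an upper orbit hitting $a$ (resp. $b$) continues with $Sa$ (resp. $T^{-1}b$). The point $a$ has the cycle property if $f^{m_1}(Sa)=f^{k_1}(Ta)$ for some non-negative integers $m_1,k_1$; it is strong if the product over the cycle is the identity transformation, $T^{-1}f^{-k_1}f^{m_1}S=\mathrm{Id}$,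 and weak otherwise. The point $b$ has the cycle property if $f^{k_2}(Sb)=f^{m_2}(T^{-1}b)$ for some non-negative integers $k_2,m_2$; it is strong if $Tf^{-m_2}f^{k_2}S=\mathrm{Id}$, and weak otherwise. Here the powers of $f$ in the products denote the corresponding products of $T,S,T^{-1}$ applied along the orbit, and the cycle is taken up to the first common value of the two orbits ($m_i+k_i$ minimal).
   Formalization: Read literally the claim fails (b+1/b=3, b<1: (ii) at a=b-1; (i) at a=-9/10). Here a common value of the two orbits counts as the end of a cycle only if it is neither a nor b, and b's cycle property is strong if some cycle, not necessarily the first, has product Id. *)

theory Defs
  imports Complex_Main
begin

text \<open>The extended real line, with a single unsigned point at infinity.\<close>

datatype xreal = Fin real | Infty

fun T_map :: "xreal \<Rightarrow> xreal" where
  "T_map (Fin x) = Fin (x + 1)"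
| "T_map Infty = Infty"

fun Tinv_map :: "xreal \<Rightarrow> xreal" where
  "Tinv_map (Fin x) = Fin (x - 1)"
| "Tinv_map Infty = Infty"

fun S_map :: "xreal \<Rightarrow> xreal" where
  "S_map (Fin x) = (if x = 0 then Infty else Fin (- 1 / x))"
| "S_map Infty = Fin 0"

definition param_set :: "(real \<times> real) set" where
  "param_set = {(a, b). a \<le> 0 \<and> 0 \<le> b \<and> b - a \<ge> 1 \<and> - a * b \<le> 1}"

text \<open>
  The factor \<open>step a b x\<close> is the transformation that the map \<open>f\<close> applies at the point \<open>x\<close>.
  None of the order conditions defining \<open>f\<close> applies to the unsigned point \<open>Infty\<close>;
  \<open>f\<close> fixes it, and it contributes the trivial factor to products along an orbit.
\<close>

fun step :: "real \<Rightarrow> real \<Rightarrow> xreal \<Rightarrow> xreal \<Rightarrow> xreal" where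
  "step a b (Fin x) = (if x < a then T_map else if x < b then S_map else Tinv_map)"
| "step a b Infty = id"

definition f_map :: "real \<Rightarrow> real \<Rightarrow> xreal \<Rightarrow> xreal" where
  "f_map a b x = step a b x x"

text \<open>
  The factors applied along lower and upper orbits: they differ from those of \<open>f\<close> at most
  at \<open>a\<close> and \<open>b\<close>, where the type of the orbit decides.
\<close>

definition lower_step :: "real \<Rightarrow> real \<Rightarrow> xreal \<Rightarrow> xreal \<Rightarrow> xreal" where
  "lower_step a b x =
     (if x = Fin a then T_map else if x = Fin b then S_map else step a b x)"

definition upper_step :: "real \<Rightarrow> real \<Rightarrow> xreal \<Rightarrow> xreal \<Rightarrow> xreal" where
  "upper_step a b x =
     (if x = Fin a then S_map else if x = Fin b then Tinv_map else step a b x)"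

primrec orbit :: "(xreal \<Rightarrow> xreal \<Rightarrow> xreal) \<Rightarrow> xreal \<Rightarrow> nat \<Rightarrow> xreal" where
  "orbit g x 0 = x"
| "orbit g x (Suc n) = g (orbit g x n) (orbit g x n)"

text \<open>The product of the first \<open>n\<close> factors along the orbit of \<open>x\<close>.\<close>

primrec orbit_prod :: "(xreal \<Rightarrow> xreal \<Rightarrow> xreal) \<Rightarrow> xreal \<Rightarrow> nat \<Rightarrow> xreal \<Rightarrow> xreal" where
  "orbit_prod g x 0 = id"
| "orbit_prod g x (Suc n) = g (orbit g x n) \<circ> orbit_prod g x n"

abbreviation lower_a :: "real \<Rightarrow> real \<Rightarrow> nat \<Rightarrow> xreal" where
  "lower_a a b \<equiv> orbit (lower_step a b) (T_map (Fin a))"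

abbreviation upper_a :: "real \<Rightarrow> real \<Rightarrow> nat \<Rightarrow> xreal" where
  "upper_a a b \<equiv> orbit (upper_step a b) (S_map (Fin a))"

abbreviation lower_b :: "real \<Rightarrow> real \<Rightarrow> nat \<Rightarrow> xreal" where
  "lower_b a b \<equiv> orbit (lower_step a b) (S_map (Fin b))"

abbreviation upper_b :: "real \<Rightarrow> real \<Rightarrow> nat \<Rightarrow> xreal" where
  "upper_b a b \<equiv> orbit (upper_step a b) (Tinv_map (Fin b))"

text \<open>
  A cycle ends where a lower and an upper orbit meet. Since a lower and an upper orbit continue
  differently from \<open>a\<close> (via \<open>T\<close> resp. \<open>S\<close>) and from \<open>b\<close> (via \<open>S\<close> resp. the inverse of \<open>T\<close>),
  they do not join if they hit \<open>a\<close> or \<open>b\<close>, and the end of a cycle is therefore required to be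
  another point. For instance, let \<open>a = b - 1\<close> and \<open>b + 1 / b = 3\<close> with \<open>b < 1\<close>. The lower
  orbit of \<open>b\<close> hits \<open>a\<close>, and so does the upper one, as it starts at \<open>b - 1\<close>; they separate at once
  and never have another point in common, and the lower and upper orbits of \<open>a\<close> are disjoint.
\<close>

definition a_cycle :: "real \<Rightarrow> real \<Rightarrow> nat \<Rightarrow> nat \<Rightarrow> bool" where
  "a_cycle a b m k \<longleftrightarrow>
     upper_a a b m = lower_a a b k \<and> upper_a a b m \<notin> {Fin a, Fin b}"

definition b_cycle :: "real \<Rightarrow> real \<Rightarrow> nat \<Rightarrow> nat \<Rightarrow> bool" where
  "b_cycle a b k m \<longleftrightarrow>
     lower_b a b k = upper_b a b m \<and> lower_b a b k \<notin> {Fin a, Fin b}"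

definition a_cycle_property :: "real \<Rightarrow> real \<Rightarrow> bool" where
  "a_cycle_property a b \<longleftrightarrow> (\<exists>m k. a_cycle a b m k)"

definition b_cycle_property :: "real \<Rightarrow> real \<Rightarrow> bool" where
  "b_cycle_property a b \<longleftrightarrow> (\<exists>k m. b_cycle a b k m)"

text \<open>
  The property is strong if the product over some cycle is the identity. It is not enough to look
  at the cycle with \<open>k + m\<close> minimal: if, for instance, \<open>b + 1 / b = 3\<close> with \<open>b < 1\<close> and
  \<open>-1 < a < b - 1\<close>, then \<open>T\<^sup>2 S b = b - 1\<close> is the start of the upper orbit of \<open>b\<close>. This
  accidental meeting, at \<open>k = 2\<close> and \<open>m = 0\<close>, has the product \<open>T\<^sup>3 S\<close>; the orbits close up to the
  identity at \<open>k = 3\<close> and \<open>m = 5\<close>.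
\<close>

definition b_strong_cycle_property :: "real \<Rightarrow> real \<Rightarrow> bool" where
  "b_strong_cycle_property a b \<longleftrightarrow>
     (\<exists>k m. b_cycle a b k m \<and>
        T_map \<circ> inv (orbit_prod (upper_step a b) (Tinv_map (Fin b)) m)
          \<circ> orbit_prod (lower_step a b) (S_map (Fin b)) k \<circ> S_map = id)"

definition periodic :: "(nat \<Rightarrow> xreal) \<Rightarrow> bool" where
  "periodic u \<longleftrightarrow> (\<exists>p>0. \<forall>n. u (n + p) = u n)"

text \<open>In the last case, \<open>\<lfloor>x - b\<rfloor> + 1\<close> differs from \<open>\<lceil>x - b\<rceil>\<close> when \<open>x - b\<close> is an integer.\<close>

definition digit :: "real \<Rightarrow> real \<Rightarrow> real \<Rightarrow> int" where
  "digit a b x = (if x < a then \<lfloor>x - a\<rfloor> else if x < b then 0 else \<lfloor>x - b\<rfloor> + 1)"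

definition f_hat :: "real \<Rightarrow> real \<Rightarrow> real \<Rightarrow> real" where
  "f_hat a b x = (if x = 0 then 0 else - 1 / x - of_int (digit a b (- 1 / x)))"

end

theory Submission
  imports Defs
begin

text \<open>
  Everything rests on one relation of the modular group, \<open>STS = T\<^sup>-\<^sup>1ST\<^sup>-\<^sup>1\<close>. Write \<open>c = STS\<close>, so
  that \<open>c(x) = x / (1 - x)\<close>. While the lower orbit of \<open>b\<close> climbs by \<open>T\<close> from \<open>Sb\<close> to
  \<open>y = T\<^sup>mSb\<close> in \<open>[a, a + 1)\<close>, the upper orbit moves by blocks \<open>S, T\<^sup>-\<^sup>1, T\<^sup>-\<^sup>1\<close>, each of which
  answers one \<open>T\<close> of the lower orbit, the last one excepted, and arrives at \<open>c(y)\<close>. From then on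
  the two orbits run in step: from the pair \<open>(x, c(x))\<close> they go to \<open>(x', c(x'))\<close>, where \<open>x'\<close> is the
  image of \<open>x\<close> under the first return map, as long as \<open>x\<close> lies in \<open>[b/(b+1), a+1]\<close>; the lower
  bound means that \<open>b \<le> c(x)\<close>, so that the upper orbit continues by \<open>T\<^sup>-\<^sup>1\<close> (\<open>upper_ascent\<close>,
  \<open>sync_run_surviving\<close>). The point \<open>a\<close> fits into the same scheme with \<open>x' = a + 1\<close>, and both
  orbits of \<open>a\<close> run in step from \<open>(a + 1, c(a + 1))\<close>.

  If \<open>x\<close> falls into the gap \<open>(a, b/(b+1))\<close>, then \<open>a \<le> c(x) < b\<close>, the upper orbit moves on to
  \<open>S(c(x)) = TSx\<close>, and the orbits meet at \<open>TSx\<close> or \<open>Sx\<close>, with equal products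
  (\<open>orbits_merge\<close>). The exception is \<open>x = 0\<close>: then \<open>c(x) = 0\<close>, the orbits have already met,
  with products that differ by the factor \<open>c\<close>, and both stay at infinity after the next step.

  Accidental meetings are excluded by position. While they run in step, the lower orbit stays in
  \<open>(-\<infinity>, a] \<union> (0, b]\<close> and the upper orbit in \<open>[a, 0) \<union> [b, \<infinity>)\<close>. These two zones have only \<open>a\<close>
  and \<open>b\<close> in common, and a cycle does not end there. So there is no cycle if the gap is never
  entered (\<open>orbits_confined\<close>, \<open>no_b_cycle_if_surviving\<close>), and for \<open>x = 0\<close> there is none besides
  those at \<open>0\<close> and at infinity (\<open>no_strong_b_cycle_if_zero\<close>).

  If the lower orbit of \<open>b\<close> hits \<open>a\<close>, the two orbits of \<open>b\<close> turn into those of \<open>a\<close>, so a cycle of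
  \<open>a\<close> gives one of \<open>b\<close>; and if \<open>a\<close> has no cycle, then its orbits never enter the gap, hence
  neither do those of \<open>b\<close>. If the lower orbit hits \<open>b/(b+1)\<close>, then \<open>c(b/(b+1)) = b\<close> and
  \<open>TS(b/(b+1)) = Sb\<close> bring both orbits back to their starting points.
\<close>

section \<open>The generators on the extended line\<close>

lemma S_S [simp]: "S_map (S_map z) = z"
  by (cases z) auto

lemma T_Tinv [simp]: "T_map (Tinv_map z) = z" "Tinv_map (T_map z) = z"
  by (cases z; simp)+

lemma bij_S [simp]: "bij S_map"
  by (rule o_bij [of S_map]) (simp_all add: fun_eq_iff)

lemma bij_T [simp]: "bij T_map"
  by (rule o_bij [of Tinv_map]) (simp_all add: fun_eq_iff)

lemma bij_Tinv [simp]: "bij Tinv_map"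
  by (rule o_bij [of T_map]) (simp_all add: fun_eq_iff)

lemma T_funpow_Fin [simp]: "(T_map ^^ i) (Fin x) = Fin (x + of_nat i)"
  by (induction i) (simp_all add: algebra_simps)

text \<open>The position of the upper orbit when the lower orbit, running in step with it, is at \<open>z\<close>.\<close>

definition companion :: "xreal \<Rightarrow> xreal" where
  "companion z = S_map (T_map (S_map z))"

text \<open>This is the relation \<open>(ST)\<^sup>3 = 1\<close> of the modular group.\<close>

lemma companion_eq_Tinv_S_Tinv: "companion z = Tinv_map (S_map (Tinv_map z))"
  by (cases z) (auto simp: companion_def field_simps)

lemma companion_T: "companion (T_map z) = Tinv_map (S_map z)"
  by (simp add: companion_eq_Tinv_S_Tinv)

lemma S_companion: "S_map (companion z) = T_map (S_map z)"
  by (simp add: companion_def)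

lemma S_Tinv_S: "S_map (Tinv_map (S_map z)) = T_map (S_map (T_map z))"
  using S_companion [of "T_map z"] by (simp add: companion_T)

lemma companion_Fin: "x \<noteq> 1 \<Longrightarrow> companion (Fin x) = Fin (x / (1 - x))"
  by (simp add: companion_eq_Tinv_S_Tinv field_simps)

lemma companion_neq_id: "companion \<noteq> id"
proof
  assume "companion = id"
  then have "companion Infty = Infty" by simp
  then show False by (simp add: companion_def)
qed

section \<open>Orbits and their products\<close>

lemma orbit_add: "orbit g p (n + k) = orbit g (orbit g p n) k"
  by (induction k) simp_all

lemma orbit_prod_add:
  "orbit_prod g p (n + k) = orbit_prod g (orbit g p n) k \<circ> orbit_prod g p n"
  by (induction k) (simp_all add: orbit_add comp_assoc)

lemma bij_orbit_prod: "(\<And>x. bij (g x)) \<Longrightarrow> bij (orbit_prod g p n)"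
  by (induction n) (simp_all add: bij_comp)

lemma orbit_periodic:
  assumes "orbit g p n = p" "0 < n"
  shows "periodic (orbit g p)"
  unfolding periodic_def using assms by (metis add.commute orbit_add)

text \<open>
  Besides the end point \<open>q\<close> and the product \<open>M\<close>, a run of \<open>n\<close> steps records that its points lie in
  the zone \<open>Z\<close>. The end point is exempt, so that a run may end where the zone is left.
\<close>

definition run ::
  "(xreal \<Rightarrow> xreal \<Rightarrow> xreal) \<Rightarrow> xreal set \<Rightarrow> xreal \<Rightarrow> nat \<Rightarrow> (xreal \<Rightarrow> xreal) \<Rightarrow> xreal \<Rightarrow> bool" where
  "run g Z p n M q \<longleftrightarrow>
     orbit g p n = q \<and> orbit_prod g p n = M \<and> (\<forall>k<n. orbit g p k \<in> Z)"

lemma run_0: "run g Z p 0 id p"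
  by (simp add: run_def)

lemma run_append:
  assumes "run g Z p n M q" "run g Z q n' M' r"
  shows "run g Z p (n + n') (M' \<circ> M) r"
proof -
  have "orbit g p k \<in> Z" if "k < n + n'" for k
  proof (cases "k < n")
    case True
    then show ?thesis using assms by (simp add: run_def)
  next
    case False
    then have "orbit g p k = orbit g q (k - n)"
      using orbit_add [of g p n "k - n"] assms by (simp add: run_def)
    then show ?thesis using that False assms by (simp add: run_def)
  qed
  then show ?thesis
    using assms by (simp add: run_def orbit_add orbit_prod_add)
qed

lemma run_Suc:
  assumes "p \<in> Z" "g p = h" "run g Z (h p) n M q"
  shows "run g Z p (Suc n) (M \<circ> h) q"
proof -
  have "run g Z p 1 h (h p)"
    using assms by (auto simp: run_def)
  from run_append [OF this assms(3)] show ?thesis by simp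
qed

text \<open>The return times may vary from point to point: a step count \<open>k\<close> is used up return by return.\<close>

lemma orbit_confined:
  assumes return: "\<And>p. p \<in> C \<Longrightarrow> \<exists>n M. 0 < n \<and> (\<exists>q\<in>C. run g Z p n M q)"
    and "p \<in> C"
  shows "orbit g p k \<in> Z"
  using \<open>p \<in> C\<close>
proof (induction k arbitrary: p rule: less_induct)
  case (less k)
  obtain n M q where n: "0 < n" "q \<in> C" "run g Z p n M q"
    using return [OF less.prems] by blast
  show ?case
  proof (cases "k < n")
    case True
    then show ?thesis using n by (simp add: run_def)
  next
    case False
    then have "orbit g p k = orbit g q (k - n)"
      using orbit_add [of g p n "k - n"] n by (simp add: run_def)
    then show ?thesis using less.IH [of "k - n" q] n False by simp
  qed
qed

lemma run_confined:
  assumes "run g Z p n M q" "\<And>k. orbit g q k \<in> Z"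
  shows "orbit g p k \<in> Z"
proof (cases "k < n")
  case True
  then show ?thesis using assms(1) by (simp add: run_def)
next
  case False
  then have "orbit g p k = orbit g q (k - n)"
    using orbit_add [of g p n "k - n"] assms(1) by (simp add: run_def)
  then show ?thesis using assms(2) by simp
qed

text \<open>After \<open>0\<close> comes the fixed point at infinity, whose factor is trivial: the product freezes.\<close>

lemma orbit_from_0:
  assumes "g (Fin 0) = S_map" "g Infty = id"
  shows "orbit g (Fin 0) (Suc j) = Infty" "orbit_prod g (Fin 0) (Suc j) = S_map"
proof -
  have "orbit g (Fin 0) (Suc j) = Infty \<and> orbit_prod g (Fin 0) (Suc j) = S_map"
    using assms by (induction j) auto
  then show "orbit g (Fin 0) (Suc j) = Infty" "orbit_prod g (Fin 0) (Suc j) = S_map"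
    by simp_all
qed

text \<open>
  This removes the inverse from the strong cycle condition: both orbits of \<open>b\<close> may be thought of as
  starting at \<open>b\<close> itself, with first factors \<open>S\<close> and \<open>T\<^sup>-\<^sup>1\<close>, and the condition compares the two
  full products.
\<close>

lemma cycle_product_eq_id_iff:
  assumes "bij U"
  shows "T_map \<circ> inv U \<circ> L \<circ> S_map = id \<longleftrightarrow> L \<circ> S_map = U \<circ> Tinv_map"
proof
  assume id: "T_map \<circ> inv U \<circ> L \<circ> S_map = id"
  have "L (S_map z) = U (Tinv_map z)" for z
  proof -
    have "Tinv_map (T_map (inv U (L (S_map z)))) = Tinv_map z"
      using fun_cong [OF id, of z] by simp
    then have "inv U (L (S_map z)) = Tinv_map z" by simp
    then show ?thesis using assms by (metis bij_inv_eq_iff)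
  qed
  then show "L \<circ> S_map = U \<circ> Tinv_map" by (simp add: fun_eq_iff)
next
  assume eq: "L \<circ> S_map = U \<circ> Tinv_map"
  have "L (S_map z) = U (Tinv_map z)" for z
    using fun_cong [OF eq, of z] by simp
  then show "T_map \<circ> inv U \<circ> L \<circ> S_map = id"
    using assms by (simp add: fun_eq_iff bij_is_inj)
qed

section \<open>Lower and upper orbits in step\<close>

locale reduction_params =
  fixes a b :: real
  assumes b_pos: "0 < b" and b_le: "b \<le> - a" and a_gt: "- a < 1" and width: "b - a \<ge> 1"
begin

abbreviation lower :: "xreal \<Rightarrow> xreal \<Rightarrow> xreal" where
  "lower \<equiv> lower_step a b"

abbreviation upper :: "xreal \<Rightarrow> xreal \<Rightarrow> xreal" where
  "upper \<equiv> upper_step a b"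

definition lower_zone :: "xreal set" where
  "lower_zone = Fin ` ({..a} \<union> {0<..b})"

definition upper_zone :: "xreal set" where
  "upper_zone = Fin ` ({a..<0} \<union> {b..})"

lemma a_bounds: "- 1 < a" "a \<le> - 1 / 2" "a < 0" "a < b" "b < 1" "a + 1 \<le> b"
  using b_pos b_le a_gt width by linarith+

text \<open>
  The conventions at \<open>a\<close> and \<open>b\<close> amount to the choice between left- and right-closed intervals.
\<close>

lemma lower_Fin:
  "lower (Fin x) = (if x \<le> a then T_map else if x \<le> b then S_map else Tinv_map)"
  using a_bounds by (auto simp: lower_step_def)

lemma upper_Fin:
  "upper (Fin x) = (if x < a then T_map else if x < b then S_map else Tinv_map)"
  using a_bounds by (auto simp: upper_step_def)

lemma step_Infty [simp]: "lower Infty = id" "upper Infty = id"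
  by (auto simp: lower_step_def upper_step_def)

lemma bij_lower: "bij (lower z)"
  by (cases z) (simp_all add: lower_Fin)

lemma bij_upper: "bij (upper z)"
  by (cases z) (simp_all add: upper_Fin)

lemma Fin_in_lower_zone [simp]: "Fin x \<in> lower_zone \<longleftrightarrow> x \<le> a \<or> 0 < x \<and> x \<le> b"
  by (auto simp: lower_zone_def)

lemma Fin_in_upper_zone [simp]: "Fin x \<in> upper_zone \<longleftrightarrow> a \<le> x \<and> x < 0 \<or> b \<le> x"
  by (auto simp: upper_zone_def)

lemma Infty_notin_zones [simp]: "Infty \<notin> lower_zone" "Infty \<notin> upper_zone"
  by (auto simp: lower_zone_def upper_zone_def)

lemma zones_meet: "z \<in> lower_zone \<Longrightarrow> z \<in> upper_zone \<Longrightarrow> z \<in> {Fin a, Fin b}"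
  using a_bounds by (cases z) auto

lemma S_a: "S_map (Fin a) = Fin (- 1 / a)" "1 < - 1 / a"
  using a_bounds by (auto simp: field_simps)

lemma companion_a: "companion (Fin a) = Fin (a / (1 - a))" "a \<le> a / (1 - a)" "a / (1 - a) < 0"
proof -
  have "a * (1 - a) \<le> a" by (simp add: algebra_simps)
  then show "companion (Fin a) = Fin (a / (1 - a))" "a \<le> a / (1 - a)" "a / (1 - a) < 0"
    using a_bounds by (simp_all add: companion_Fin pos_le_divide_eq divide_neg_pos)
qed

lemma lower_ascent:
  assumes "u < a" "u + of_nat i < a + 1"
  shows "run lower lower_zone (Fin u) i (T_map ^^ i) (Fin (u + of_nat i))"
  using assms
proof (induction i)
  case 0
  show ?case using run_0 [of lower lower_zone "Fin u"] by (simp add: id_def)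
next
  case (Suc i)
  have "run lower lower_zone (Fin u) i (T_map ^^ i) (Fin (u + of_nat i))"
    using Suc by simp
  moreover have "run lower lower_zone (Fin (u + of_nat i)) 1 T_map (Fin (u + of_nat (Suc i)))"
    using Suc.prems by (simp add: run_def lower_Fin)
  ultimately show ?case
    by (metis Suc_eq_plus1 run_append funpow.simps(2))
qed

text \<open>
  The answer of the upper orbit to \<open>i\<close> lower steps \<open>T\<close>, which lead from \<open>u\<close> to \<open>u + i\<close>. As long as
  \<open>u + 1 < a\<close>, the identity \<open>S(T\<^sup>-\<^sup>1Su) = TS(Tu)\<close> makes the factors \<open>S, T\<^sup>-\<^sup>1, T\<^sup>-\<^sup>1\<close> carry
  \<open>T\<^sup>-\<^sup>1Su\<close> to \<open>T\<^sup>-\<^sup>1S(u + 1)\<close>; at the last step \<open>T\<^sup>-\<^sup>1Su\<close> is the companion of \<open>u + 1\<close>. The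
  bound \<open>-1/b \<le> u\<close> says that \<open>Su \<ge> b\<close>; it keeps the upper orbit on the sides of \<open>a\<close> and \<open>b\<close>
  where these factors are the prescribed ones.
\<close>

lemma upper_ascent:
  assumes "- 1 / b \<le> u" "u < a" "a \<le> u + of_nat i" "u + of_nat i < a + 1"
  shows "\<exists>l W. run upper upper_zone (Tinv_map (S_map (Fin u))) l W (companion (Fin (u + of_nat i)))
    \<and> W \<circ> Tinv_map \<circ> S_map = companion \<circ> (T_map ^^ i)"
  using assms
proof (induction i arbitrary: u)
  case 0
  then show ?case by simp
next
  case (Suc i)
  have neg: "u < 0" using Suc.prems a_bounds by linarith
  have Su: "Tinv_map (S_map (Fin u)) = Fin (- 1 / u - 1)" using neg by simp
  show ?case
  proof (cases "a \<le> u + 1")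
    case True
    then have "i = 0" using Suc.prems by simp
    have "run upper upper_zone (Tinv_map (S_map (Fin u))) 0 id (companion (Fin (u + 1)))"
      using run_0 companion_T [of "Fin u"] by simp
    moreover have "id \<circ> Tinv_map \<circ> S_map = companion \<circ> T_map"
      by (simp add: fun_eq_iff companion_T)
    ultimately show ?thesis
      using \<open>i = 0\<close> by (metis One_nat_def comp_id funpow.simps of_nat_1)
  next
    case False
    then have u1: "u + 1 < a" by simp
    have "- 1 / b \<le> u + 1" using Suc.prems by simp
    then obtain l W where W:
      "run upper upper_zone (Tinv_map (S_map (Fin (u + 1)))) l W (companion (Fin (u + 1 + of_nat i)))"
      "W \<circ> Tinv_map \<circ> S_map = companion \<circ> (T_map ^^ i)"
      using Suc.IH [of "u + 1"] Suc.prems u1 by (fastforce simp del: S_map.simps)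
    have u1neg: "u + 1 < 0" using u1 a_bounds by linarith
    have "b \<le> - 1 / u"
      using Suc.prems(1) neg b_pos by (simp add: field_simps)
    moreover have "- 1 / u < 1" using u1 a_bounds neg by (simp add: field_simps)
    ultimately have 1: "a \<le> - 1 / u - 1" "- 1 / u - 1 < 0" using width by linarith+
    have "b < - 1 / (u + 1)"
    proof -
      have "b * (- (u + 1)) < b * (1 / b)"
        using Suc.prems(1) b_pos by (intro mult_strict_left_mono) auto
      then show ?thesis using u1neg b_pos by (simp add: field_simps)
    qed
    moreover have "0 < - 1 / (u + 1)" using u1neg by (simp add: field_simps)
    ultimately have 2: "b < - 1 / (u + 1)" "b \<le> - 1 / (u + 1) + 1" by simp_all
    have S1: "S_map (Fin (- 1 / u - 1)) = Fin (- 1 / (u + 1) + 1)"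
      using S_Tinv_S [of "Fin u"] neg u1neg by (simp del: S_map.simps add: Su) simp
    have Su1: "S_map (Fin (u + 1)) = Fin (- 1 / (u + 1))" using u1neg by simp
    have r1: "run upper upper_zone (Fin (- 1 / (u + 1))) (Suc l) (W \<circ> Tinv_map) (companion (Fin (u + 1 + of_nat i)))"
      by (rule run_Suc) (use W(1) 2 a_bounds in \<open>simp_all only: Su1 upper_Fin Fin_in_upper_zone, auto\<close>)
    have r2: "run upper upper_zone (Fin (- 1 / (u + 1) + 1)) (Suc (Suc l)) (W \<circ> Tinv_map \<circ> Tinv_map)
        (companion (Fin (u + 1 + of_nat i)))"
      by (rule run_Suc) (use r1 2 a_bounds in \<open>auto simp: upper_Fin\<close>)
    have "run upper upper_zone (Fin (- 1 / u - 1)) (Suc (Suc (Suc l)))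
        (W \<circ> Tinv_map \<circ> Tinv_map \<circ> S_map) (companion (Fin (u + 1 + of_nat i)))"
      by (rule run_Suc) (use r2 1 a_bounds b_pos in \<open>simp_all only: S1 upper_Fin Fin_in_upper_zone, auto\<close>)
    moreover have "W \<circ> Tinv_map \<circ> Tinv_map \<circ> S_map \<circ> Tinv_map \<circ> S_map = companion \<circ> (T_map ^^ Suc i)"
    proof
      fix z
      have "W (Tinv_map (S_map (T_map z))) = companion ((T_map ^^ i) (T_map z))"
        using fun_cong [OF W(2), of "T_map z"] by simp
      then show "(W \<circ> Tinv_map \<circ> Tinv_map \<circ> S_map \<circ> Tinv_map \<circ> S_map) z = (companion \<circ> (T_map ^^ Suc i)) z"
        by (simp add: S_Tinv_S funpow_swap1)
    qed
    ultimately show ?thesis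
      unfolding Su by (metis (no_types, opaque_lifting) add.assoc add.commute of_nat_Suc)
  qed
qed

text \<open>The positions of the lower orbit from which the two orbits continue in step without meeting.\<close>

definition surviving :: "real set" where
  "surviving = {a} \<union> {b / (b + 1)..a + 1}"

text \<open>
  The next position of the lower orbit in \<open>[a, a + 1]\<close> at which the upper orbit is at the companion.
  At \<open>a\<close> the lower orbit goes on by \<open>T\<close>, unlike the first return map.
\<close>

definition next_sync :: "real \<Rightarrow> real" where
  "next_sync x = (if x = a then a + 1 else f_hat a b x)"

text \<open>
  The last condition says that \<open>W = cRc\<^sup>-\<^sup>1\<close>: the products of orbits in step are conjugate by the
  companion map \<open>c\<close>.
\<close>

definition sync_run ::
  "real \<Rightarrow> nat \<Rightarrow> nat \<Rightarrow> (xreal \<Rightarrow> xreal) \<Rightarrow> (xreal \<Rightarrow> xreal) \<Rightarrow> real \<Rightarrow> bool" where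
  "sync_run x k l R W x' \<longleftrightarrow>
     run lower lower_zone (Fin x) k R (Fin x') \<and>
     run upper upper_zone (companion (Fin x)) l W (companion (Fin x')) \<and>
     W \<circ> companion = companion \<circ> R"

lemma sync_run_append:
  assumes "sync_run x k l R W x'" "sync_run x' k' l' R' W' x''"
  shows "sync_run x (k + k') (l + l') (R' \<circ> R) (W' \<circ> W) x''"
proof -
  have "W' \<circ> W \<circ> companion = companion \<circ> (R' \<circ> R)"
    using assms unfolding sync_run_def by (metis comp_assoc)
  then show ?thesis
    using assms run_append unfolding sync_run_def by blast
qed

lemma f_hat_eqI:
  assumes "0 < x" "- 1 / x < a" "a \<le> - 1 / x + of_nat i" "- 1 / x + of_nat i < a + 1"
  shows "f_hat a b x = - 1 / x + of_nat i"
proof -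
  have "\<lfloor>- 1 / x - a\<rfloor> = - int i"
    using assms by (intro floor_unique) auto
  then show ?thesis using assms by (simp add: f_hat_def digit_def)
qed

lemma ascent_exists:
  assumes "u < a"
  obtains i :: nat where "a \<le> u + of_nat i" "u + of_nat i < a + 1"
proof
  have "\<lfloor>u - a\<rfloor> < 0" using assms by (simp add: floor_less_iff)
  then have "real (nat (- \<lfloor>u - a\<rfloor>)) = - of_int \<lfloor>u - a\<rfloor>" by simp
  then show "a \<le> u + of_nat (nat (- \<lfloor>u - a\<rfloor>))" "u + of_nat (nat (- \<lfloor>u - a\<rfloor>)) < a + 1"
    by linarith+
qed

text \<open>
  For \<open>x \<noteq> a\<close> put \<open>u = TSx = 1 - 1/x\<close>. The lower orbit takes two steps to \<open>u\<close> and then ascends,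
  and the companion of \<open>x\<close> is \<open>Su\<close>, from which the upper orbit ascends in parallel; the condition
  \<open>b/(b+1) \<le> x\<close> is \<open>-1/b \<le> u\<close>. For \<open>x = a\<close> the upper orbit passes from \<open>c(a)\<close> through \<open>TSa\<close> and
  \<open>Sa\<close> to \<open>T\<^sup>-\<^sup>1Sa = c(a + 1)\<close>.
\<close>

lemma sync_run_surviving:
  assumes "x \<in> surviving"
  shows "\<exists>k l R W. 0 < k \<and> 0 < l \<and> sync_run x k l R W (next_sync x)"
    and "next_sync x \<in> {a..a + 1}"
proof -
  have "(\<exists>k l R W. 0 < k \<and> 0 < l \<and> sync_run x k l R W (next_sync x)) \<and> next_sync x \<in> {a..a + 1}"
  proof (cases "x = a")
    case True
    have r: "next_sync x = a + 1" using True by (simp add: next_sync_def)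
    have low: "run lower lower_zone (Fin a) 1 T_map (Fin (a + 1))"
      by (simp add: run_def lower_Fin)
    note c = companion_a
    have e: "companion (Fin (a + 1)) = Fin (- 1 / a - 1)"
      using companion_T [of "Fin a"] S_a by simp
    have Sc: "S_map (Fin (a / (1 - a))) = Fin (- 1 / a + 1)"
      using S_companion [of "Fin a"] c(1) S_a(1) by simp
    have "run upper upper_zone (Fin (a / (1 - a))) (Suc (Suc (Suc 0)))
        (id \<circ> Tinv_map \<circ> Tinv_map \<circ> S_map) (Fin (- 1 / a - 1))"
    proof (rule run_Suc)
      show "run upper upper_zone (S_map (Fin (a / (1 - a)))) (Suc (Suc 0))
          (id \<circ> Tinv_map \<circ> Tinv_map) (Fin (- 1 / a - 1))"
        unfolding Sc
      proof (rule run_Suc)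
        show "run upper upper_zone (Tinv_map (Fin (- 1 / a + 1))) (Suc 0)
           (id \<circ> Tinv_map) (Fin (- 1 / a - 1))"
          by (rule run_Suc) (use S_a(2) a_bounds run_0 in \<open>auto simp: upper_Fin\<close>)
      qed (use S_a(2) a_bounds in \<open>auto simp: upper_Fin\<close>)
    qed (use c a_bounds in \<open>auto simp: upper_Fin\<close>)
    moreover have "id \<circ> Tinv_map \<circ> Tinv_map \<circ> S_map \<circ> companion = companion \<circ> T_map"
      by (simp add: fun_eq_iff S_companion companion_T)
    ultimately have "sync_run x 1 (Suc (Suc (Suc 0))) T_map (id \<circ> Tinv_map \<circ> Tinv_map \<circ> S_map) (a + 1)"
      unfolding sync_run_def True using low c(1) e by simp
    then show ?thesis unfolding r using a_bounds
      by (metis atLeastAtMost_iff less_add_one less_imp_le order_refl zero_less_Suc zero_less_one)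
  next
    case False
    then have x: "b / (b + 1) \<le> x" "x \<le> a + 1" using assms by (auto simp: surviving_def)
    have pos: "0 < x" using x b_pos by (meson divide_pos_pos add_pos_pos zero_less_one less_le_trans)
    define u where "u = 1 - 1 / x"
    have x2: "x \<le> 1 / 2" using x a_bounds by linarith
    then have inv2: "2 \<le> 1 / x" using pos by (simp add: field_simps)
    have u: "u < a" "u \<le> -1" "- 1 / x < a" using inv2 a_bounds by (auto simp: u_def)
    have "1 / x \<le> 1 / (b / (b + 1))" using x(1) b_pos pos by (intro divide_left_mono) auto
    then have u_ge: "- 1 / b \<le> u" using b_pos by (simp add: u_def field_simps)
    obtain i where i: "a \<le> u + of_nat i" "u + of_nat i < a + 1"
      using ascent_exists u(1) by blast
    have fh: "next_sync x = u + of_nat i"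
      using f_hat_eqI [of x "Suc i"] pos u i False by (simp add: next_sync_def u_def)
    have Sx: "S_map (Fin x) = Fin (- 1 / x)" using pos by simp
    have r1: "run lower lower_zone (Fin u) i (T_map ^^ i) (Fin (u + of_nat i))"
      using lower_ascent u(1) i by blast
    have Tx: "T_map (Fin (- 1 / x)) = Fin u" by (simp add: u_def)
    have r2: "run lower lower_zone (Fin (- 1 / x)) (Suc i) ((T_map ^^ i) \<circ> T_map) (Fin (u + of_nat i))"
      by (rule run_Suc) (use r1 u(3) in \<open>simp_all only: Tx lower_Fin Fin_in_lower_zone, auto\<close>)
    have low: "run lower lower_zone (Fin x) (Suc (Suc i)) ((T_map ^^ i) \<circ> T_map \<circ> S_map) (Fin (u + of_nat i))"
      by (rule run_Suc) (use r2 pos x(2) a_bounds in \<open>simp_all only: Sx lower_Fin Fin_in_lower_zone, auto\<close>)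
    have c: "companion (Fin x) = S_map (Fin u)"
      using pos by (simp add: companion_def u_def)
    have b_le_c: "b \<le> - 1 / u" using u_ge u(2) b_pos by (simp add: field_simps)
    obtain l W where W:
      "run upper upper_zone (Tinv_map (S_map (Fin u))) l W (companion (Fin (u + of_nat i)))"
      "W \<circ> Tinv_map \<circ> S_map = companion \<circ> (T_map ^^ i)"
      using upper_ascent u_ge u(1) i by blast
    have "run upper upper_zone (companion (Fin x)) (Suc l) (W \<circ> Tinv_map) (companion (Fin (u + of_nat i)))"
      unfolding c
      by (rule run_Suc) (use W(1) u(2) b_le_c a_bounds in \<open>auto simp: upper_Fin\<close>)
    moreover have "W \<circ> Tinv_map \<circ> companion = companion \<circ> ((T_map ^^ i) \<circ> T_map \<circ> S_map)"
      using W(2) by (simp add: fun_eq_iff companion_def)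
    ultimately show ?thesis
      using low i unfolding fh sync_run_def by (metis atLeastAtMost_iff less_imp_le zero_less_Suc)
  qed
  then show "\<exists>k l R W. 0 < k \<and> 0 < l \<and> sync_run x k l R W (next_sync x)"
    and "next_sync x \<in> {a..a + 1}" by blast+
qed

lemma sync_run_funpow:
  assumes "\<And>j. j < n \<Longrightarrow> (next_sync ^^ j) x \<in> surviving"
  shows "\<exists>k l R W. sync_run x k l R W ((next_sync ^^ n) x)"
  using assms
proof (induction n)
  case 0
  have "sync_run x 0 0 id id x" by (simp add: sync_run_def run_0)
  then show ?case by (metis funpow_0)
next
  case (Suc n)
  then obtain k l R W where "sync_run x k l R W ((next_sync ^^ n) x)" by force
  moreover obtain k' l' R' W' where
    "sync_run ((next_sync ^^ n) x) k' l' R' W' ((next_sync ^^ Suc n) x)"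
    using sync_run_surviving(1) [of "(next_sync ^^ n) x"] Suc.prems by auto
  ultimately show ?case using sync_run_append by blast
qed

lemma orbits_confined:
  assumes "\<And>j. (next_sync ^^ j) x \<in> surviving"
  shows "orbit lower (Fin x) k \<in> lower_zone" "orbit upper (companion (Fin x)) k \<in> upper_zone"
proof -
  define X where "X = range (\<lambda>j. (next_sync ^^ j) x)"
  have x: "x \<in> X" unfolding X_def by (rule range_eqI [of _ _ 0]) simp
  have X: "\<exists>k l R W. 0 < k \<and> 0 < l \<and> sync_run z k l R W (next_sync z)" "next_sync z \<in> X"
    if z: "z \<in> X" for z
  proof -
    obtain j where j: "z = (next_sync ^^ j) x" using z by (auto simp: X_def)
    then show "\<exists>k l R W. 0 < k \<and> 0 < l \<and> sync_run z k l R W (next_sync z)"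
      using sync_run_surviving(1) assms by blast
    show "next_sync z \<in> X" unfolding X_def j by (rule range_eqI [of _ _ "Suc j"]) simp
  qed
  show "orbit lower (Fin x) k \<in> lower_zone"
  proof (rule orbit_confined [where C = "Fin ` X"])
    fix p assume "p \<in> Fin ` X"
    then show "\<exists>n M. 0 < n \<and> (\<exists>q\<in>Fin ` X. run lower lower_zone p n M q)"
      using X unfolding sync_run_def by blast
  qed (use x in simp)
  show "orbit upper (companion (Fin x)) k \<in> upper_zone"
  proof (rule orbit_confined [where C = "(companion \<circ> Fin) ` X"])
    fix p assume "p \<in> (companion \<circ> Fin) ` X"
    then show "\<exists>n M. 0 < n \<and> (\<exists>q\<in>(companion \<circ> Fin) ` X. run upper upper_zone p n M q)"
      using X unfolding sync_run_def by fastforce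
  qed (use x in simp)
qed

text \<open>
  Below \<open>b/(b+1)\<close> the companion is less than \<open>b\<close>, so the upper orbit applies \<open>S\<close> and reaches \<open>TSx\<close>,
  one \<open>T\<close> away from the next point \<open>Sx\<close> of the lower orbit. If \<open>x > 0\<close>, the lower orbit is below
  \<open>a\<close> and closes this distance by \<open>T\<close>; if \<open>x < 0\<close>, the upper orbit is above \<open>b\<close> and closes it by
  \<open>T\<^sup>-\<^sup>1\<close>. If \<open>x = 0\<close>, both orbits are at \<open>0\<close> already.
\<close>

lemma orbits_merge:
  assumes "a < x" "x < b / (b + 1)"
  obtains k l where
    "orbit lower (Fin x) k = orbit upper (companion (Fin x)) l"
    "orbit lower (Fin x) k \<notin> {Fin a, Fin b}"
    "x \<noteq> 0 \<Longrightarrow> orbit_prod upper (companion (Fin x)) l \<circ> companion = orbit_prod lower (Fin x) k"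
proof -
  have "b / (b + 1) < b" using b_pos by (simp add: field_simps)
  then have xb: "x < b" using assms by linarith
  have c: "companion (Fin x) = Fin (x / (1 - x))"
    using xb a_bounds by (intro companion_Fin) auto
  have cb: "x / (1 - x) < b"
    using assms xb a_bounds b_pos by (simp add: field_simps)
  have ca: "a \<le> x / (1 - x)"
  proof -
    have "a * (1 - x) \<le> x"
    proof (cases "0 \<le> x")
      case True
      then show ?thesis using a_bounds xb by (smt (verit) mult_nonpos_nonneg)
    next
      case False
      then have "a * (1 - x) \<le> a * 1" using a_bounds by (intro mult_left_mono_neg) auto
      then show ?thesis using assms by simp
    qed
    then show ?thesis using xb a_bounds by (simp add: field_simps)
  qed
  have up: "upper (companion (Fin x)) = S_map" unfolding c using ca cb by (simp add: upper_Fin)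
  have lo: "lower (Fin x) = S_map" using assms xb by (simp add: lower_Fin)
  consider "x = 0" | "0 < x" | "x < 0" by linarith
  then show ?thesis
  proof cases
    case 1
    show ?thesis
      by (rule that [of 0 0]) (use 1 c a_bounds b_pos in auto)
  next
    case 2
    have "1 / x > 1 / (b / (b + 1))" using 2 assms b_pos by (intro divide_strict_left_mono) auto
    then have "1 / x > 1 + 1 / b" using b_pos by (simp add: field_simps)
    moreover have "1 / b > 1" using b_pos a_bounds by (simp add: field_simps)
    ultimately have far: "- 1 / x + 1 < a" using a_bounds by linarith
    have lo2: "lower (S_map (Fin x)) = T_map" using 2 far by (simp add: lower_Fin)
    show ?thesis
    proof (rule that [of 2 1])
      show "orbit lower (Fin x) 2 = orbit upper (companion (Fin x)) 1"
        using lo lo2 up by (simp add: numeral_2_eq_2 S_companion)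
      show "orbit lower (Fin x) 2 \<notin> {Fin a, Fin b}"
        using lo lo2 2 far a_bounds by (simp add: numeral_2_eq_2)
      show "orbit_prod upper (companion (Fin x)) 1 \<circ> companion = orbit_prod lower (Fin x) 2"
        using lo lo2 up by (simp add: numeral_2_eq_2 fun_eq_iff S_companion)
    qed
  next
    case 3
    have far: "1 < - 1 / x" using 3 assms a_bounds by (simp add: field_simps)
    have up2: "upper (S_map (companion (Fin x))) = Tinv_map"
      unfolding S_companion using 3 far a_bounds by (simp add: upper_Fin)
    show ?thesis
    proof (rule that [of 1 2])
      show "orbit lower (Fin x) 1 = orbit upper (companion (Fin x)) 2"
        using lo up up2 by (simp add: numeral_2_eq_2 S_companion)
      show "orbit lower (Fin x) 1 \<notin> {Fin a, Fin b}"
        using lo 3 far a_bounds by simp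
      show "orbit_prod upper (companion (Fin x)) 2 \<circ> companion = orbit_prod lower (Fin x) 1"
        using lo up up2 by (simp add: numeral_2_eq_2 fun_eq_iff S_companion)
    qed
  qed
qed

section \<open>The orbits of the two discontinuities\<close>

text \<open>
  The first position outside the surviving set is in the gap \<open>(a, b/(b+1))\<close>, where the orbits meet.
  The count starts at \<open>a + 1\<close>, because \<open>Ta = a + 1\<close> is the start of the lower orbit of \<open>a\<close> and its
  companion \<open>T\<^sup>-\<^sup>1Sa\<close> is one step after the start \<open>Sa\<close> of the upper one.
\<close>

lemma a_cycle_or_surviving:
  assumes "\<not> a_cycle_property a b"
  shows "(next_sync ^^ j) a \<in> surviving"
proof (rule ccontr)
  assume "\<not> ?thesis"
  then obtain n where n: "(next_sync ^^ n) a \<notin> surviving"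
      "\<And>j. j < n \<Longrightarrow> (next_sync ^^ j) a \<in> surviving"
    using exists_least_iff [of "\<lambda>n. (next_sync ^^ n) a \<notin> surviving"] by blast
  let ?x = "(next_sync ^^ n) a"
  have "n \<noteq> 0" using n(1) by (auto simp: surviving_def intro: gr0I)
  then obtain n' where n': "n = Suc n'" by (cases n) auto
  have "?x \<in> {a..a + 1}"
    using sync_run_surviving(2) [OF n(2) [of n']] n' by simp
  then have x: "a < ?x" "?x < b / (b + 1)" using n(1) by (auto simp: surviving_def)
  have shift: "(next_sync ^^ n) a = (next_sync ^^ n') (a + 1)"
    unfolding n' by (simp add: funpow_swap1) (simp add: next_sync_def)
  have "(next_sync ^^ j) (a + 1) \<in> surviving" if "j < n'" for j
    using n(2) [of "Suc j"] that n' by (simp add: funpow_swap1) (simp add: next_sync_def)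
  then obtain k l R W where s: "sync_run (a + 1) k l R W ?x"
    using sync_run_funpow [of n' "a + 1"] shift by auto
  obtain k' l' where m: "orbit lower (Fin ?x) k' = orbit upper (companion (Fin ?x)) l'"
      "orbit lower (Fin ?x) k' \<notin> {Fin a, Fin b}"
    using orbits_merge [OF x] by metis
  have "upper (S_map (Fin a)) = Tinv_map" using S_a a_bounds by (simp add: upper_Fin)
  then have "orbit upper (S_map (Fin a)) 1 = companion (Fin (a + 1))"
    using companion_T [of "Fin a"] by simp
  then have "upper_a a b (1 + (l + l')) = orbit upper (companion (Fin ?x)) l'"
    using s by (simp only: orbit_add sync_run_def run_def)
  moreover have "lower_a a b (k + k') = orbit lower (Fin ?x) k'"
    using s by (simp add: orbit_add sync_run_def run_def)
  ultimately have "a_cycle a b (1 + (l + l')) (k + k')" using m by (simp add: a_cycle_def)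
  then show False using assms by (auto simp: a_cycle_property_def)
qed

text \<open>
  Since \<open>b = S(Sb)\<close>, the start \<open>T\<^sup>-\<^sup>1b\<close> of the upper orbit is \<open>T\<^sup>-\<^sup>1Su\<close> for \<open>u = Sb\<close>, the start of
  the lower one: the two orbits ascend in parallel to \<open>y\<close> and its companion.
\<close>

lemma b_orbits_reach:
  assumes y: "y = - 1 / b + of_nat m" "a \<le> y" "y < a + 1"
    and surv: "\<And>j. j < n \<Longrightarrow> (next_sync ^^ j) y \<in> surviving"
  obtains k l R W where
    "run lower lower_zone (S_map (Fin b)) k R (Fin ((next_sync ^^ n) y))"
    "run upper upper_zone (Tinv_map (Fin b)) l W (companion (Fin ((next_sync ^^ n) y)))"
    "W \<circ> Tinv_map = companion \<circ> R \<circ> S_map"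
proof -
  obtain k l R W where s: "sync_run y k l R W ((next_sync ^^ n) y)"
    using sync_run_funpow surv by blast
  have Sb: "S_map (Fin b) = Fin (- 1 / b)" using b_pos by simp
  have "1 < 1 / b" using b_pos a_bounds by (simp add: field_simps)
  then have u: "- 1 / b < a" using a_bounds by linarith
  have "run lower lower_zone (S_map (Fin b)) m (T_map ^^ m) (Fin y)"
    unfolding Sb y(1) using lower_ascent u y by blast
  then have 1: "run lower lower_zone (S_map (Fin b)) (m + k) (R \<circ> (T_map ^^ m)) (Fin ((next_sync ^^ n) y))"
    using s unfolding sync_run_def by (blast intro: run_append)
  obtain l0 W0 where W0:
    "run upper upper_zone (Tinv_map (S_map (Fin (- 1 / b)))) l0 W0 (companion (Fin y))"
    "W0 \<circ> Tinv_map \<circ> S_map = companion \<circ> (T_map ^^ m)"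
    using upper_ascent [of "- 1 / b" m] u y by auto
  have "S_map (Fin (- 1 / b)) = Fin b" using b_pos by simp
  then have 2: "run upper upper_zone (Tinv_map (Fin b)) (l0 + l) (W \<circ> W0)
      (companion (Fin ((next_sync ^^ n) y)))"
    using s W0(1) unfolding sync_run_def by (metis run_append)
  have "(W \<circ> W0 \<circ> Tinv_map) z = (companion \<circ> (R \<circ> (T_map ^^ m)) \<circ> S_map) z" for z
  proof -
    have "W0 (Tinv_map z) = companion ((T_map ^^ m) (S_map z))"
      using fun_cong [OF W0(2), of "S_map z"] by simp
    moreover have "W (companion z') = companion (R z')" for z'
      using s unfolding sync_run_def by (metis comp_apply)
    ultimately show ?thesis by simp
  qed
  then have 3: "W \<circ> W0 \<circ> Tinv_map = companion \<circ> (R \<circ> (T_map ^^ m)) \<circ> S_map" by blast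
  show ?thesis by (rule that [OF 1 2 3])
qed

lemma no_b_cycle_if_surviving:
  assumes y: "y = - 1 / b + of_nat m" "a \<le> y" "y < a + 1"
    and surv: "\<And>j. (next_sync ^^ j) y \<in> surviving"
  shows "\<not> b_cycle_property a b"
proof -
  obtain k l R W where r:
    "run lower lower_zone (S_map (Fin b)) k R (Fin y)"
    "run upper upper_zone (Tinv_map (Fin b)) l W (companion (Fin y))"
    using b_orbits_reach [OF y, of 0] by (metis funpow_0 not_less0)
  have "lower_b a b i \<in> lower_zone" for i
    using run_confined [OF r(1)] orbits_confined(1) surv by blast
  moreover have "upper_b a b i \<in> upper_zone" for i
    using run_confined [OF r(2)] orbits_confined(2) surv by blast
  ultimately show ?thesis
    unfolding b_cycle_property_def b_cycle_def by (metis zones_meet)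
qed

lemma b_cycle_if_merging:
  assumes lo: "run lower Z (S_map (Fin b)) k R (Fin x)"
    and up: "run upper Z' (Tinv_map (Fin b)) l W (companion (Fin x))"
    and W: "W \<circ> Tinv_map = companion \<circ> R \<circ> S_map"
    and x: "a < x" "x < b / (b + 1)"
  shows "b_cycle_property a b" and "x \<noteq> 0 \<Longrightarrow> b_strong_cycle_property a b"
proof -
  obtain k' l' where m: "orbit lower (Fin x) k' = orbit upper (companion (Fin x)) l'"
      "orbit lower (Fin x) k' \<notin> {Fin a, Fin b}"
      "x \<noteq> 0 \<Longrightarrow> orbit_prod upper (companion (Fin x)) l' \<circ> companion = orbit_prod lower (Fin x) k'"
    using orbits_merge [OF x] by metis
  have cyc: "b_cycle a b (k + k') (l + l')"
    using m lo up by (simp add: b_cycle_def orbit_add run_def)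
  then show "b_cycle_property a b" by (auto simp: b_cycle_property_def)
  assume "x \<noteq> 0"
  have "orbit_prod lower (S_map (Fin b)) (k + k') \<circ> S_map
      = orbit_prod lower (Fin x) k' \<circ> R \<circ> S_map"
    using lo by (simp add: orbit_prod_add run_def)
  also have "\<dots> = orbit_prod upper (companion (Fin x)) l' \<circ> (companion \<circ> R \<circ> S_map)"
    unfolding m(3) [OF \<open>x \<noteq> 0\<close>, symmetric] by (simp only: comp_assoc)
  also have "\<dots> = orbit_prod upper (Tinv_map (Fin b)) (l + l') \<circ> Tinv_map"
    unfolding W [symmetric] using up by (simp add: orbit_prod_add run_def comp_assoc)
  finally show "b_strong_cycle_property a b"
    unfolding b_strong_cycle_property_def
    using cyc cycle_product_eq_id_iff bij_orbit_prod bij_upper by blast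
qed

text \<open>
  The zones leave only the meetings at \<open>0\<close>, with products \<open>RS\<close> and \<open>cRS\<close>, and those at infinity, where
  both products have the additional factor \<open>S\<close>; equality would force \<open>c\<close> to be the identity.
\<close>

lemma no_strong_b_cycle_if_zero:
  assumes lo: "run lower lower_zone (S_map (Fin b)) K R (Fin 0)"
    and up: "run upper upper_zone (Tinv_map (Fin b)) L W (companion (Fin 0))"
    and W: "W \<circ> Tinv_map = companion \<circ> R \<circ> S_map"
  shows "\<not> b_strong_cycle_property a b"
proof
  let ?U = "orbit_prod upper (Tinv_map (Fin b))"
  let ?L = "orbit_prod lower (S_map (Fin b))"
  assume "b_strong_cycle_property a b"
  then obtain k l where cyc: "b_cycle a b k l" and "T_map \<circ> inv (?U l) \<circ> ?L k \<circ> S_map = id"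
    by (auto simp: b_strong_cycle_property_def)
  then have eq: "?L k \<circ> S_map = ?U l \<circ> Tinv_map"
    using cycle_product_eq_id_iff bij_orbit_prod bij_upper by blast
  have c0: "companion (Fin 0) = Fin 0" by (simp add: companion_Fin)
  have g0: "lower (Fin 0) = S_map" "upper (Fin 0) = S_map"
    using a_bounds b_pos by (simp_all add: lower_Fin upper_Fin)
  have low: "lower_b a b k \<in> lower_zone \<or> k = K \<and> lower_b a b k = Fin 0 \<and> ?L k = R
      \<or> lower_b a b k = Infty \<and> ?L k = S_map \<circ> R"
  proof (cases k K rule: linorder_cases)
    case greater
    then obtain j where "k = K + Suc j" by (metis less_imp_Suc_add add_Suc_right)
    then show ?thesis
      using lo orbit_from_0 [of lower, OF g0(1) step_Infty(1), of j]
      by (simp only: orbit_add orbit_prod_add run_def) simp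
  qed (use lo in \<open>auto simp: run_def\<close>)
  have upp: "upper_b a b l \<in> upper_zone \<or> l = L \<and> upper_b a b l = Fin 0 \<and> ?U l = W
      \<or> upper_b a b l = Infty \<and> ?U l = S_map \<circ> W"
  proof (cases l L rule: linorder_cases)
    case greater
    then obtain j where "l = L + Suc j" by (metis less_imp_Suc_add add_Suc_right)
    then show ?thesis
      using up orbit_from_0 [of upper, OF g0(2) step_Infty(2), of j]
      by (simp only: orbit_add orbit_prod_add run_def c0) simp
  qed (use up c0 in \<open>auto simp: run_def\<close>)
  have surj: "surj (R \<circ> S_map)"
    using lo bij_orbit_prod [of lower, OF bij_lower]
    by (metis run_def bij_S bij_comp bij_is_surj)
  have cancel: "F = id" if "R \<circ> S_map = F \<circ> (R \<circ> S_map)" for F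
  proof
    fix z
    obtain w where "z = (R \<circ> S_map) w" using surj by (rule surjE)
    then show "F z = id z" using fun_cong [OF that, of w] by simp
  qed
  define z where "z = lower_b a b k"
  have z: "upper_b a b l = z" "z \<notin> {Fin a, Fin b}"
    using cyc unfolding b_cycle_def z_def by metis+
  have "Fin 0 \<notin> lower_zone" "Fin 0 \<notin> upper_zone" using a_bounds b_pos by auto
  then consider "?L k = R" "?U l = W" | "?L k = S_map \<circ> R" "?U l = S_map \<circ> W"
    using low [folded z_def] upp [unfolded z(1)] z(2) zones_meet [of z] by auto
  then show False
  proof cases
    case 1
    then have "R \<circ> S_map = companion \<circ> (R \<circ> S_map)" using eq W by (simp add: comp_assoc)
    then show False using cancel companion_neq_id by blast
  next
    case 2
    then have e: "S_map \<circ> R \<circ> S_map = S_map \<circ> W \<circ> Tinv_map" using eq by simp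
    have "R \<circ> S_map = companion \<circ> (R \<circ> S_map)"
      using arg_cong [OF e, of "\<lambda>F. S_map \<circ> F"] W by (simp add: fun_eq_iff)
    then show False using cancel companion_neq_id by blast
  qed
qed

text \<open>
  The lower orbit enters that of \<open>a\<close> by \<open>Ta\<close>, one step after \<open>a\<close>, and the upper orbit by \<open>Sa\<close>, two
  steps after \<open>c(a)\<close>, through \<open>TSa\<close>.
\<close>

lemma a_cycle_imp_b_cycle:
  assumes lo: "run lower Z (S_map (Fin b)) k R (Fin a)"
    and up: "run upper Z' (Tinv_map (Fin b)) l W (companion (Fin a))"
    and "a_cycle_property a b"
  shows "b_cycle_property a b"
proof -
  obtain i j where cyc: "a_cycle a b i j" using assms(3) by (auto simp: a_cycle_property_def)
  note c = companion_a
  have "upper (companion (Fin a)) = S_map" using c b_pos by (simp add: upper_Fin)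
  moreover have "upper (T_map (S_map (Fin a))) = Tinv_map" using S_a a_bounds by (simp add: upper_Fin)
  ultimately have "orbit upper (companion (Fin a)) 2 = S_map (Fin a)"
    by (simp add: numeral_2_eq_2 S_companion del: S_map.simps)
  then have "upper_b a b (l + (2 + i)) = upper_a a b i"
    using up by (simp only: orbit_add run_def)
  moreover have "orbit lower (Fin a) 1 = T_map (Fin a)" by (simp add: lower_Fin)
  then have "lower_b a b (k + (1 + j)) = lower_a a b j"
    using lo by (simp only: orbit_add run_def)
  ultimately have "b_cycle a b (k + (1 + j)) (l + (2 + i))"
    using cyc unfolding a_cycle_def b_cycle_def by metis
  then show ?thesis by (auto simp: b_cycle_property_def)
qed

end

theorem theorem4p2:
  fixes a b y :: real and m :: nat
  assumes "(a, b) \<in> param_set"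
    and "0 < b" and "b \<le> - a" and "- a < 1"
    and "m \<ge> 1"
    and "(T_map ^^ m) (S_map (Fin b)) = Fin y"
    and "a \<le> y" and "y < a + 1"
  shows
    "(\<forall>n. (\<forall>k<n. (f_hat a b ^^ k) y \<in> {b / (b + 1)<..<a + 1}) \<and>
          (f_hat a b ^^ n) y \<in> {a..b / (b + 1)} \<longrightarrow>
        ((f_hat a b ^^ n) y \<in> {a<..<b / (b + 1)} \<longrightarrow>
           b_cycle_property a b \<and>
           (b_strong_cycle_property a b \<longleftrightarrow> (f_hat a b ^^ n) y \<noteq> 0)) \<and>
        ((f_hat a b ^^ n) y = a \<longrightarrow>
           (b_cycle_property a b \<longleftrightarrow> a_cycle_property a b)) \<and>
        ((f_hat a b ^^ n) y = b / (b + 1) \<longrightarrow>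
           \<not> b_cycle_property a b \<and> periodic (lower_b a b) \<and> periodic (upper_b a b)))
     \<and> ((\<forall>k. (f_hat a b ^^ k) y \<in> {b / (b + 1)<..<a + 1}) \<longrightarrow>
        \<not> b_cycle_property a b)"
proof -
  interpret reduction_params a b
    using assms by unfold_locales (auto simp: param_set_def)
  have y: "y = - 1 / b + of_nat m" "a \<le> y" "y < a + 1"
    using assms b_pos by simp_all
  have small: "0 < b / (b + 1)" using b_pos by simp
  let ?h = "\<lambda>j. (f_hat a b ^^ j) y"
  have same: "(next_sync ^^ n) y = ?h n"
    if "\<And>j. j < n \<Longrightarrow> ?h j \<in> {b / (b + 1)<..<a + 1}" for n
    using that
  proof (induction n)
    case (Suc n)
    have "b / (b + 1) < ?h n" using Suc.prems [of n] by simp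
    then have "?h n \<noteq> a" using a_bounds small by linarith
    then show ?case using Suc by (simp add: next_sync_def)
  qed simp
  have part_I:
    "(?h n \<in> {a<..<b / (b + 1)} \<longrightarrow>
        b_cycle_property a b \<and> (b_strong_cycle_property a b \<longleftrightarrow> ?h n \<noteq> 0)) \<and>
     (?h n = a \<longrightarrow> (b_cycle_property a b \<longleftrightarrow> a_cycle_property a b)) \<and>
     (?h n = b / (b + 1) \<longrightarrow>
        \<not> b_cycle_property a b \<and> periodic (lower_b a b) \<and> periodic (upper_b a b))"
    if gap: "\<And>k. k < n \<Longrightarrow> ?h k \<in> {b / (b + 1)<..<a + 1}" for n
  proof -
    have same_le: "(next_sync ^^ j) y = ?h j" if "j \<le> n" for j
      using same gap that by simp
    have surv: "(next_sync ^^ j) y \<in> surviving" if "j < n" for j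
      using gap [OF that] same_le [of j] that by (auto simp: surviving_def)
    obtain k l R W where r:
      "run lower lower_zone (S_map (Fin b)) k R (Fin (?h n))"
      "run upper upper_zone (Tinv_map (Fin b)) l W (companion (Fin (?h n)))"
      "W \<circ> Tinv_map = companion \<circ> R \<circ> S_map"
      using b_orbits_reach [OF y, of n] surv same_le [of n] by (metis order_refl)
    show ?thesis
    proof (intro conjI impI)
      assume "?h n \<in> {a<..<b / (b + 1)}"
      then have x: "a < ?h n" "?h n < b / (b + 1)" by auto
      show "b_cycle_property a b" by (rule b_cycle_if_merging(1) [OF r x])
      show "b_strong_cycle_property a b \<longleftrightarrow> ?h n \<noteq> 0"
        using b_cycle_if_merging(2) [OF r x] no_strong_b_cycle_if_zero r by metis
    next
      assume hit: "?h n = a"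
      \<comment> \<open>From step \<open>n\<close> on, the positions are those of the chain of \<open>a\<close>.\<close>
      have "\<not> b_cycle_property a b" if no: "\<not> a_cycle_property a b"
      proof (rule no_b_cycle_if_surviving [OF y])
        fix j
        show "(next_sync ^^ j) y \<in> surviving"
        proof (cases "j < n")
          case False
          then have "(next_sync ^^ j) y = (next_sync ^^ (j - n)) ((next_sync ^^ n) y)"
            by (metis comp_apply funpow_add le_add_diff_inverse2 linorder_not_less)
          then show ?thesis using a_cycle_or_surviving [OF no] same_le [of n] hit by simp
        qed (rule surv)
      qed
      then show "b_cycle_property a b \<longleftrightarrow> a_cycle_property a b"
        using a_cycle_imp_b_cycle r hit by metis
    next
      assume hit: "?h n = b / (b + 1)"
      have Sh: "S_map (Fin (b / (b + 1))) = Fin (- 1 / b - 1)" using b_pos by (simp add: field_simps)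
      have Sb: "S_map (Fin b) = Fin (- 1 / b)" using b_pos by simp
      have "1 < 1 / b" using b_pos a_bounds by (simp add: field_simps)
      then have far: "- 1 / b - 1 \<le> a" using a_bounds by linarith
      have hb: "b / (b + 1) \<le> b" "a < b / (b + 1)"
        using b_pos a_bounds small by (simp add: field_simps, linarith)
      have "run lower lower_zone (Fin (b / (b + 1))) (Suc (Suc 0)) (id \<circ> T_map \<circ> S_map) (Fin (- 1 / b))"
      proof (rule run_Suc)
        show "run lower lower_zone (S_map (Fin (b / (b + 1)))) (Suc 0) (id \<circ> T_map) (Fin (- 1 / b))"
          unfolding Sh by (rule run_Suc) (use far run_0 in \<open>auto simp: lower_Fin\<close>)
      qed (use small hb a_bounds in \<open>auto simp: lower_Fin\<close>)
      then have low: "run lower lower_zone (S_map (Fin b)) (k + Suc (Suc 0)) (id \<circ> T_map \<circ> S_map \<circ> R)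
          (S_map (Fin b))"
        using r(1) unfolding hit Sb by (blast intro: run_append)
      have cb: "companion (Fin (b / (b + 1))) = Fin b"
        using b_pos by (subst companion_Fin) (simp_all add: field_simps)
      have "run upper upper_zone (Fin b) (Suc 0) (id \<circ> Tinv_map) (Tinv_map (Fin b))"
        by (rule run_Suc) (use run_0 a_bounds in \<open>auto simp: upper_Fin\<close>)
      then have upp: "run upper upper_zone (Tinv_map (Fin b)) (l + Suc 0) (id \<circ> Tinv_map \<circ> W)
          (Tinv_map (Fin b))"
        using r(2) unfolding hit cb by (blast intro: run_append)
      show "periodic (lower_b a b)" "periodic (upper_b a b)"
        using low upp orbit_periodic unfolding run_def by blast+
      have "lower_b a b i \<in> lower_zone" for i
        by (rule orbit_confined [where C = "{S_map (Fin b)}"]) (use low in blast)+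
      moreover have "upper_b a b i \<in> upper_zone" for i
        by (rule orbit_confined [where C = "{Tinv_map (Fin b)}"]) (use upp in blast)+
      ultimately show "\<not> b_cycle_property a b"
        unfolding b_cycle_property_def b_cycle_def by (metis zones_meet)
    qed
  qed
  have part_II: "\<not> b_cycle_property a b" if "\<And>k. ?h k \<in> {b / (b + 1)<..<a + 1}"
  proof (rule no_b_cycle_if_surviving [OF y])
    fix j
    show "(next_sync ^^ j) y \<in> surviving"
      using that [of j] same [of j, OF that] unfolding surviving_def by auto
  qed
  show ?thesis
    using part_I part_II by blast
qed

end
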